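(* Let $r_1,r_2<\infty$ and $\mathcal{X}=\{(i_1,i_2)^T: i_1=1,\dots,r_1,\ i_2=1,\dots,r_2\}$ with the bimonotone order: $\boldsymbol{x}_1\preceq\boldsymbol{x}_2$ iff $x_{1,1}\le x_{2,1}$ and $x_{1,2}\le x_{2,2}$. Let $\mathring{g}:\mathcal{X}\to\mathbb{R}$ be isotonic (bimonotone increasing), and suppose that $$Y_i=\mathring{g}(\boldsymbol{x}_i)+\varepsilon_i,\qquad i=1,\dots,n,$$ where the $\boldsymbol{x}_i\in\mathcal{X}$ are deterministic design points and $(\varepsilon_i)$ is a sequence of identically distributed random variables with $\mathbb{E}[\varepsilon_i]=0$ and $\mathrm{Var}[\varepsilon_i]=\sigma^2<\infty$. Let $w^{(n)}_{\boldsymbol{x}}=\frac1n\sum_{i=1}^n1\{\boldsymbol{x}_i=\boldsymbol{x}\}$ and suppose that the design points satisfy $\boldsymbol{w}^{(n)}=(w^{(n)}_{\boldsymbol{x}})_{\boldsymbol{x}\in\mathcal{X}}\to\boldsymbol{w}$ as $n\to\infty$, where $\boldsymbol{w}\in\mathbb{R}_+^{r_1\times r_2}$ has strictly positive components. Let $$\hat{g}_n(\boldsymbol{x})=\frac{\sum_{i=1}^nY_i1\{\boldsymbol{x}_i=\boldsymbol{x}\}}{\sum_{i=1}^n1\{\boldsymbol{x}_i=\boldsymbol{x}\}},\qquad \hat{g}_n^{*}=\underset{f}{\mathrm{argmin}}\sum_{\boldsymbol{x}\in\mathcal{X}}(f(\boldsymbol{x})-\hat{g}_n(\boldsymbol{x}))^2w^{(n)}_{\boldsymbol{x}},$$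 the minimum being over all isotonic functions $f$ on $\mathcal{X}$ (so $\hat g_n^*$ is the least squares estimator of $\mathring g$ under bimonotone constraints). Then $$n^{1/2}(\hat{\boldsymbol{g}}_n^{*}-\mathring{\boldsymbol{g}})\stackrel{d}{\to}\varphi^{\boldsymbol{w}}(\boldsymbol{Y}_{\boldsymbol{0},\Sigma}),$$ where $\boldsymbol{Y}_{\boldsymbol{0},\Sigma}$ is a Gaussian vector with mean zero and diagonal covariance matrix $\Sigma$ whose diagonal elements are $\Sigma_{ii}=\sigma^2w_i$, with $i$ indexing the $r_1r_2$ points of $\mathcal{X}$, and $\varphi^{\boldsymbol{w}}$ maps a vector $\boldsymbol{\theta}$ indexed by $\mathcal{X}$ to the concatenation of the separate isotonic regressions with weights $\boldsymbol{w}$ of the restrictions of $\boldsymbol{\theta}$ to the comparable level sets of $\mathring{g}$.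
   Context: A bold symbol denotes the vector of values of the corresponding function on $\mathcal{X}$. Two elements $x,y$ are comparable if $x\preceq y$ or $y\preceq x$. A function $f$ on $A\subseteq\mathcal{X}$ is isotonic if $x,y\in A$, $x\preceq y$ imply $f(x)\le f(y)$. The isotonic regression of $\theta$ over $A\subseteq\mathcal{X}$ with positive weights $\boldsymbol{w}$ is the (unique) minimizer of $\sum_{x\in A}(f(x)-\theta(x))^2w_x$ over isotonic functions $f$ on $A$. Comparable level sets of $\mathring{g}$: take the level sets $\{x\in\mathcal{X}:\mathring{g}(x)=c\}$ and partition each of them into the connected components of the graph whose vertices are the elements of the level set and whose edges join comparable elements. These components partition $\mathcal{X}$. Operator $\varphi^{\boldsymbol{w}}$: $\varphi^{\boldsymbol{w}}(\boldsymbol{\theta})_{x}$ is the value at $x$ of the isotonic regression with weights $\boldsymbol{w}$, over the comparable level set containing $x$, of the restriction of $\theta$ to that set.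
   Formalization: The errors are additionally assumed independent (identically distributed alone is not enough, e.g. all errors equal), and the limiting covariance has diagonal entries σ²/w_i instead of the printed σ²w_i, which is wrong already for two points with strictly increasing g. *)

theory Defs
  imports "HOL-Probability.Probability"
begin

text \<open>Isotonic functions are \<^const>\<open>mono_on\<close>; on \<^typ>\<open>nat \<times> nat\<close> the library order
  \<open>\<le>\<close> is componentwise, i.e. the bimonotone order.  Vectors indexed by \<open>I\<close> are
  extensional functions on \<open>I\<close>.\<close>

definition isotonic_regression :: "'i::order set \<Rightarrow> ('i \<Rightarrow> real) \<Rightarrow> ('i \<Rightarrow> real) \<Rightarrow> 'i \<Rightarrow> real" where
  "isotonic_regression A w \<theta> =
     (ARG_MIN (\<lambda>f. \<Sum>x\<in>A. (f x - \<theta> x)\<^sup>2 * w x) f. f \<in> extensional A \<and> mono_on A f)"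

definition comparability_edges :: "'i::order set \<Rightarrow> ('i \<times> 'i) set" where
  "comparability_edges L = {(u, v). u \<in> L \<and> v \<in> L \<and> (u \<le> v \<or> v \<le> u)}"

text \<open>The connected component of \<open>x\<close>, for \<open>x \<in> I\<close>, in the comparability graph of its level set.\<close>

definition comparable_level_set :: "'i::order set \<Rightarrow> ('i \<Rightarrow> real) \<Rightarrow> 'i \<Rightarrow> 'i set" where
  "comparable_level_set I g x = (comparability_edges {z \<in> I. g z = g x})\<^sup>* `` {x}"

definition levelwise_isotonic_regression ::
    "'i::order set \<Rightarrow> ('i \<Rightarrow> real) \<Rightarrow> ('i \<Rightarrow> real) \<Rightarrow> ('i \<Rightarrow> real) \<Rightarrow> 'i \<Rightarrow> real" where
  "levelwise_isotonic_regression I g w \<theta> =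
     (\<lambda>x\<in>I. isotonic_regression (comparable_level_set I g x) w \<theta> x)"

definition design_weight :: "(nat \<Rightarrow> 'i) \<Rightarrow> nat \<Rightarrow> 'i \<Rightarrow> real" where
  "design_weight d n x = (\<Sum>i=1..n. of_bool (d i = x)) / real n"

definition cell_mean :: "(nat \<Rightarrow> 'i) \<Rightarrow> (nat \<Rightarrow> real) \<Rightarrow> nat \<Rightarrow> 'i \<Rightarrow> real" where
  "cell_mean d y n x = (\<Sum>i=1..n. y i * of_bool (d i = x)) / (\<Sum>i=1..n. of_bool (d i = x))"

definition isotonic_lse :: "'i::order set \<Rightarrow> (nat \<Rightarrow> 'i) \<Rightarrow> (nat \<Rightarrow> real) \<Rightarrow> nat \<Rightarrow> 'i \<Rightarrow> real" where
  "isotonic_lse I d y n = isotonic_regression I (design_weight d n) (cell_mean d y n)"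

text \<open>Variance \<open>0\<close> is allowed and gives the point mass at the mean.\<close>

definition normal_law :: "real \<Rightarrow> real \<Rightarrow> real measure" where
  "normal_law m v = distr std_normal_distribution borel (\<lambda>z. m + sqrt v * z)"

text \<open>Law on \<open>\<real>\<^sup>I\<close> (\<open>I\<close> finite) of the Gaussian vector with mean zero and diagonal
  covariance matrix with diagonal \<open>v\<close>.\<close>

definition centered_diag_gaussian :: "'i set \<Rightarrow> ('i \<Rightarrow> real) \<Rightarrow> ('i \<Rightarrow> real) measure" where
  "centered_diag_gaussian I v = (\<Pi>\<^sub>M x\<in>I. normal_law 0 (v x))"

definition weak_conv_vec :: "'i set \<Rightarrow> (nat \<Rightarrow> ('i \<Rightarrow> real) measure) \<Rightarrow> ('i \<Rightarrow> real) measure \<Rightarrow> bool" where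
  "weak_conv_vec I \<mu> \<nu> \<longleftrightarrow>
     (\<forall>f. continuous_map (powertop_real I) euclideanreal f \<and> bounded (f ` topspace (powertop_real I)) \<longrightarrow>
        (\<lambda>n. \<integral>z. f z \<partial>\<mu> n) \<longlonglongrightarrow> (\<integral>z. f z \<partial>\<nu>))"

definition converges_in_distribution ::
    "'a measure \<Rightarrow> 'i set \<Rightarrow> (nat \<Rightarrow> 'a \<Rightarrow> 'i \<Rightarrow> real) \<Rightarrow> ('i \<Rightarrow> real) measure \<Rightarrow> bool" where
  "converges_in_distribution M I Z \<nu> \<longleftrightarrow>
     weak_conv_vec I (\<lambda>n. distr M (\<Pi>\<^sub>M x\<in>I. borel) (\<lambda>\<omega>. restrict (Z n \<omega>) I)) \<nu>"

end

theory Submission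
  imports Defs
begin

text \<open>
  The isotonic regression depends continuously on the data and the weights jointly, and it is
  positively homogeneous. If \<open>\<theta>\<close> is small enough, then \<open>g\<close> plus the levelwise regression of \<open>\<theta>\<close> is
  still isotonic, because \<open>g\<close> jumps by a positive amount between comparable points of different
  level sets; as it minimizes the loss on every comparable level set separately, it is then the
  regression of \<open>g + \<theta>\<close>. Hence, for \<open>z\<^sub>n \<longlonglongrightarrow> z\<close>, the rescaled error of the regression of
  \<open>g + z\<^sub>n / sqrt n\<close> tends to the levelwise regression of \<open>z\<close>.

  The rescaled cell means of the noise are independent, and the law of each depends only on the
  cell count, so the one-dimensional central limit theorem and Skorohod's theorem, applied once
  and transported to a product space, give versions of them that converge pointwise. Dominated
  convergence finishes the proof. For small \<open>n\<close> some cells may be empty and the regression is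
  not unique, possibly not even measurable, but this concerns only finitely many \<open>n\<close>.
\<close>

subsection \<open>Isotonic regression on a finite set\<close>

text \<open>With any function in place of the data \<open>\<theta>\<close> the same sum is the
  squared weighted distance of two functions; both readings are used below.\<close>

definition weighted_sq_loss :: "'i set \<Rightarrow> ('i \<Rightarrow> real) \<Rightarrow> ('i \<Rightarrow> real) \<Rightarrow> ('i \<Rightarrow> real) \<Rightarrow> real" where
  "weighted_sq_loss A w \<theta> f = (\<Sum>x\<in>A. (f x - \<theta> x)\<^sup>2 * w x)"

lemma isotonic_regression_alt:
  "isotonic_regression A w \<theta> =
     (ARG_MIN (weighted_sq_loss A w \<theta>) f. f \<in> extensional A \<and> mono_on A f)"
  unfolding isotonic_regression_def weighted_sq_loss_def ..

text \<open>Only the differences \<open>f x - \<theta> x\<close> enter, so \<open>g\<close> may be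
  added to or removed from both arguments. The localization at level sets rests on this.\<close>

lemma weighted_sq_loss_cong:
  assumes "\<And>x. x \<in> A \<Longrightarrow> f x - \<theta> x = f' x - \<theta>' x" "\<And>x. x \<in> A \<Longrightarrow> w x = w' x"
  shows "weighted_sq_loss A w \<theta> f = weighted_sq_loss A w' \<theta>' f'"
  unfolding weighted_sq_loss_def using assms by (intro sum.cong) auto

lemma weighted_sq_loss_restrict [simp]:
  "weighted_sq_loss A w \<theta> (restrict f A) = weighted_sq_loss A w \<theta> f"
  by (rule weighted_sq_loss_cong) auto

lemma weighted_sq_loss_nonneg:
  "(\<And>x. x \<in> A \<Longrightarrow> 0 \<le> w x) \<Longrightarrow> 0 \<le> weighted_sq_loss A w \<theta> f"
  unfolding weighted_sq_loss_def by (intro sum_nonneg) auto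

text \<open>Midpoints of isotonic functions are isotonic, so this identity bounds the distance of
  two near-minimizers by their excess over the infimum.\<close>

lemma weighted_sq_loss_parallelogram:
  "weighted_sq_loss A w \<theta> f + weighted_sq_loss A w \<theta> h =
     2 * weighted_sq_loss A w \<theta> (\<lambda>x. (f x + h x) / 2) + weighted_sq_loss A w h f / 2"
  unfolding weighted_sq_loss_def sum_distrib_left sum_divide_distrib sum.distrib[symmetric]
  by (intro sum.cong refl) (simp add: power2_eq_square field_simps)

lemma mono_on_restrict_iff [simp]: "mono_on A (restrict f A) \<longleftrightarrow> mono_on A f"
  by (auto simp: monotone_on_def)

lemma weighted_sq_loss_term_le:
  assumes "finite A" "\<forall>x\<in>A. 0 < w x" "x \<in> A"
  shows "(f x - \<theta> x)\<^sup>2 * w x \<le> weighted_sq_loss A w \<theta> f"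
  unfolding weighted_sq_loss_def
  using assms by (intro member_le_sum[where f = "\<lambda>x. (f x - \<theta> x)\<^sup>2 * w x"]) (auto simp: less_imp_le)

text \<open>By the parallelogram identity a minimizing sequence is Cauchy in every coordinate.\<close>

lemma isotonic_minimizer_exists:
  fixes A :: "'i::order set"
  assumes A: "finite A" and w: "\<forall>x\<in>A. 0 < w x"
  shows "\<exists>f. f \<in> extensional A \<and> mono_on A f \<and>
    (\<forall>h. mono_on A h \<longrightarrow> weighted_sq_loss A w \<theta> f \<le> weighted_sq_loss A w \<theta> h)"
proof -
  let ?J = "weighted_sq_loss A w \<theta>"
  \<comment> \<open>Values outside \<open>A\<close> do not affect the loss, so the infimum may range
    over all isotonic functions; \<open>restrict\<close> restores extensionality at the end.\<close>
  define m where "m = Inf (?J ` {f. mono_on A f})"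
  have J_nonneg: "0 \<le> ?J f" for f
    using w by (intro weighted_sq_loss_nonneg) (auto simp: less_imp_le)
  then have bdd: "bdd_below (?J ` {f. mono_on A f})"
    by (intro bdd_belowI[of _ 0]) auto
  have m_le: "m \<le> ?J f" if "mono_on A f" for f
    unfolding m_def using that by (intro cINF_lower[OF bdd]) auto
  have "\<exists>f. mono_on A f \<and> ?J f < m + 1 / real (Suc n)" for n
  proof -
    have ne: "?J ` {f. mono_on A f} \<noteq> {}"
      by (auto intro!: exI[of _ "\<lambda>_. 0"] simp: monotone_on_def)
    have "Inf (?J ` {f. mono_on A f}) < m + 1 / real (Suc n)"
      by (simp add: m_def)
    from cInf_lessD[OF ne this] show ?thesis by auto
  qed
  then obtain F where F: "\<And>n. mono_on A (F n)" "\<And>n. ?J (F n) < m + 1 / real (Suc n)"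
    by metis
  have dist: "weighted_sq_loss A w (F k) (F n) \<le> 2 / real (Suc n) + 2 / real (Suc k)" for n k
  proof -
    have "mono_on A (\<lambda>x. (F n x + F k x) / 2)"
      using F(1)[of n] F(1)[of k] by (auto simp: monotone_on_def intro!: divide_right_mono add_mono)
    note mid = this
    have "2 / real (Suc n) = 2 * (1 / real (Suc n))" "2 / real (Suc k) = 2 * (1 / real (Suc k))"
      by simp_all
    with m_le[OF mid] weighted_sq_loss_parallelogram[of A w \<theta> "F n" "F k"] F(2)[of n] F(2)[of k]
    show ?thesis by linarith
  qed
  have "Cauchy (\<lambda>n. F n x)" if x: "x \<in> A" for x
  proof (rule CauchyI)
    fix e :: real assume e: "0 < e"
    have "(\<lambda>n. 1 / real (Suc n)) \<longlonglongrightarrow> 0"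
      by (rule LIMSEQ_Suc[OF lim_1_over_n])
    \<comment> \<open>Each of the two terms in \<open>dist\<close> is then below half of
      \<open>e\<^sup>2 * w x\<close>.\<close>
    then have "eventually (\<lambda>n. 1 / real (Suc n) < e\<^sup>2 * w x / 4) sequentially"
      using e bspec[OF w x] by (intro order_tendstoD) auto
    then obtain N where N: "\<And>n. n \<ge> N \<Longrightarrow> 1 / real (Suc n) < e\<^sup>2 * w x / 4"
      by (auto simp: eventually_sequentially)
    show "\<exists>N. \<forall>m\<ge>N. \<forall>n\<ge>N. norm (F m x - F n x) < e"
    proof (intro exI allI impI)
      fix p q assume pq: "p \<ge> N" "q \<ge> N"
      have "(F p x - F q x)\<^sup>2 * w x \<le> 2 / real (Suc p) + 2 / real (Suc q)"
        using weighted_sq_loss_term_le[of A w x "F p" "F q", OF A w x] dist[of q p] by linarith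
      also have "\<dots> < e\<^sup>2 * w x"
      proof -
        have "2 / real (Suc p) = 2 * (1 / real (Suc p))" "2 / real (Suc q) = 2 * (1 / real (Suc q))"
          by simp_all
        with N[OF pq(1)] N[OF pq(2)] show ?thesis by linarith
      qed
      finally have "(F p x - F q x)\<^sup>2 < e\<^sup>2"
        using bspec[OF w x] by simp
      then show "norm (F p x - F q x) < e"
        using e power2_less_imp_less[of "\<bar>F p x - F q x\<bar>" e] by simp
    qed
  qed
  then have "\<forall>x\<in>A. \<exists>l. (\<lambda>n. F n x) \<longlonglongrightarrow> l"
    by (auto simp: Cauchy_convergent_iff convergent_def)
  then obtain L where L: "\<And>x. x \<in> A \<Longrightarrow> (\<lambda>n. F n x) \<longlonglongrightarrow> L x"
    by metis
  have mono: "mono_on A L"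
  proof (rule mono_onI)
    fix x y assume "x \<in> A" "y \<in> A" "x \<le> y"
    then show "L x \<le> L y"
      using F(1) by (intro LIMSEQ_le[OF L L]) (auto simp: monotone_on_def)
  qed
  have "(\<lambda>n. ?J (F n)) \<longlonglongrightarrow> ?J L"
    unfolding weighted_sq_loss_def by (intro tendsto_intros L)
  moreover have "(\<lambda>n. m + 1 / real (Suc n)) \<longlonglongrightarrow> m + 0"
    by (intro tendsto_intros LIMSEQ_Suc[OF lim_1_over_n])
  ultimately have "?J L \<le> m"
    using F(2) by (intro LIMSEQ_le[of _ "?J L" _ m]) (auto intro: less_imp_le)
  then show ?thesis
    using mono m_le by (intro exI[of _ "restrict L A"]) (auto intro: order_trans)
qed

text \<open>The midpoint of two minimizers cannot have smaller loss, so by the parallelogram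
  identity their weighted distance is 0.\<close>

lemma isotonic_minimizer_unique:
  fixes A :: "'i::order set"
  assumes A: "finite A" and w: "\<forall>x\<in>A. 0 < w x"
    and f: "mono_on A f" "\<And>k. mono_on A k \<Longrightarrow> weighted_sq_loss A w \<theta> f \<le> weighted_sq_loss A w \<theta> k"
    and h: "mono_on A h" "\<And>k. mono_on A k \<Longrightarrow> weighted_sq_loss A w \<theta> h \<le> weighted_sq_loss A w \<theta> k"
    and x: "x \<in> A"
  shows "f x = h x"
proof -
  have "mono_on A (\<lambda>x. (f x + h x) / 2)"
    using f(1) h(1) by (auto simp: monotone_on_def intro!: divide_right_mono add_mono)
  then have "weighted_sq_loss A w h f \<le> 0"
    using weighted_sq_loss_parallelogram[of A w \<theta> f h] f(2)[of "\<lambda>x. (f x + h x) / 2"] h(2)[of "\<lambda>x. (f x + h x) / 2"] by linarith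
  then have "(f x - h x)\<^sup>2 * w x \<le> 0"
    using weighted_sq_loss_term_le[of A w x f h, OF A w x] by linarith
  then show ?thesis
    using bspec[OF w x] by (auto simp: mult_le_0_iff)
qed

text \<open>\<open>ARG_MIN\<close> is a mere choice; existence of a minimizer is what gives it the
  expected properties. Competitors \<open>h\<close> need not be extensional, as the loss only sees
  \<open>A\<close>.\<close>

lemma
  fixes A :: "'i::order set"
  assumes A: "finite A" and w: "\<forall>x\<in>A. 0 < w x"
  shows isotonic_regression_mono: "mono_on A (isotonic_regression A w \<theta>)"
    and isotonic_regression_le:
      "mono_on A h \<Longrightarrow> weighted_sq_loss A w \<theta> (isotonic_regression A w \<theta>) \<le> weighted_sq_loss A w \<theta> h"
proof -
  let ?J = "weighted_sq_loss A w \<theta>"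
  obtain f where f: "f \<in> extensional A" "mono_on A f" "\<And>h. mono_on A h \<Longrightarrow> ?J f \<le> ?J h"
    using isotonic_minimizer_exists[OF A w] by metis
  have "mono_on A (isotonic_regression A w \<theta>) \<and>
    (\<forall>h. mono_on A h \<longrightarrow> ?J (isotonic_regression A w \<theta>) \<le> ?J h)"
    unfolding isotonic_regression_alt
  proof (rule arg_minI[where x = f])
    fix k assume k: "k \<in> extensional A \<and> mono_on A k"
      "\<forall>y. y \<in> extensional A \<and> mono_on A y \<longrightarrow> \<not> ?J y < ?J k"
    then have "?J k \<le> ?J f" using f by force
    then show "mono_on A k \<and> (\<forall>h. mono_on A h \<longrightarrow> ?J k \<le> ?J h)"
      using f(3) k(1) by (meson order_trans)
  qed (use f in \<open>auto simp: not_less\<close>)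
  then show "mono_on A (isotonic_regression A w \<theta>)"
    "mono_on A h \<Longrightarrow> ?J (isotonic_regression A w \<theta>) \<le> ?J h"
    by auto
qed

text \<open>Uniqueness in the form used to identify a regression: the candidate \<open>f\<close> is
  arbitrary outside \<open>A\<close>, hence equality only at points of \<open>A\<close>.\<close>

lemma isotonic_regression_eqI:
  fixes A :: "'i::order set"
  assumes A: "finite A" and w: "\<forall>x\<in>A. 0 < w x"
    and f: "mono_on A f" "\<And>h. mono_on A h \<Longrightarrow> weighted_sq_loss A w \<theta> f \<le> weighted_sq_loss A w \<theta> h"
    and x: "x \<in> A"
  shows "isotonic_regression A w \<theta> x = f x"
  using isotonic_regression_mono[OF A w] isotonic_regression_le[OF A w] f x
  by (intro isotonic_minimizer_unique[of A w _ \<theta>, OF A w]) auto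

lemma isotonic_regression_cong:
  assumes "\<And>x. x \<in> A \<Longrightarrow> \<theta> x = \<theta>' x"
  shows "isotonic_regression A w \<theta> = isotonic_regression A w \<theta>'"
proof -
  have "weighted_sq_loss A w \<theta> = weighted_sq_loss A w \<theta>'"
    using assms by (intro ext weighted_sq_loss_cong) auto
  then show ?thesis unfolding isotonic_regression_alt by simp
qed

text \<open>The isotonic functions form a cone and the loss is homogeneous of degree 2, so scaling
  by \<open>c\<close> maps one minimization problem to the other.\<close>

lemma isotonic_regression_scale:
  fixes A :: "'i::order set"
  assumes A: "finite A" and w: "\<forall>x\<in>A. 0 < w x" and c: "0 < c" and x: "x \<in> A"
  shows "isotonic_regression A w (\<lambda>x. c * \<theta> x) x = c * isotonic_regression A w \<theta> x"
proof -
  have scale: "weighted_sq_loss A w (\<lambda>x. c * \<theta> x) (\<lambda>x. c * f x) = c\<^sup>2 * weighted_sq_loss A w \<theta> f" for f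
    unfolding weighted_sq_loss_def sum_distrib_left
    by (intro sum.cong refl) (simp add: power2_eq_square algebra_simps)
  show ?thesis
  proof (rule isotonic_regression_eqI[of A w "\<lambda>x. c * isotonic_regression A w \<theta> x", OF A w])
    show "mono_on A (\<lambda>x. c * isotonic_regression A w \<theta> x)"
      using isotonic_regression_mono[of A w \<theta>, OF A w] c by (simp add: monotone_on_def)
    fix h :: "'i \<Rightarrow> real" assume "mono_on A h"
    then have "mono_on A (\<lambda>x. h x / c)"
      using c by (simp add: monotone_on_def divide_right_mono)
    moreover have "weighted_sq_loss A w (\<lambda>x. c * \<theta> x) h = c\<^sup>2 * weighted_sq_loss A w \<theta> (\<lambda>x. h x / c)"
      using scale[of "\<lambda>x. h x / c"] c by simp
    ultimately
    show "weighted_sq_loss A w (\<lambda>x. c * \<theta> x) (\<lambda>x. c * isotonic_regression A w \<theta> x)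
        \<le> weighted_sq_loss A w (\<lambda>x. c * \<theta> x) h"
      using isotonic_regression_le[OF A w] by (simp add: scale mult_left_mono)
  qed (use x in auto)
qed

text \<open>First-order optimality condition: the regression is the projection of
  \<open>\<theta>\<close> onto a convex set, and the residual makes no acute angle with any feasible
  direction \<open>h - a\<close>.\<close>

lemma isotonic_regression_variational:
  fixes A :: "'i::order set" and \<theta> :: "'i \<Rightarrow> real"
  assumes A: "finite A" and w: "\<forall>x\<in>A. 0 < w x" and h: "mono_on A h"
  defines "a \<equiv> isotonic_regression A w \<theta>"
  shows "(\<Sum>x\<in>A. w x * (\<theta> x - a x) * (h x - a x)) \<le> 0"
proof -
  define S where "S = (\<Sum>x\<in>A. w x * (\<theta> x - a x) * (h x - a x))"
  define Q where "Q = (\<Sum>x\<in>A. w x * (h x - a x)\<^sup>2)"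
  have a: "mono_on A a" unfolding a_def by (rule isotonic_regression_mono[OF A w])
  \<comment> \<open>Compare \<open>a\<close> with points of the segment from \<open>a\<close> to
    \<open>h\<close>. Expanded in \<open>t\<close>, the loss changes by
    \<open>t * (t * Q - 2 * S)\<close>, which must be nonnegative; afterwards \<open>t\<close> tends
    to 0.\<close>
  have le: "2 * S \<le> t * Q" if t: "0 < t" "t < 1" for t
  proof -
    have "mono_on A (\<lambda>x. (1 - t) * a x + t * h x)"
      using a h t by (auto simp: monotone_on_def intro!: add_mono mult_left_mono)
    then have "weighted_sq_loss A w \<theta> a \<le> weighted_sq_loss A w \<theta> (\<lambda>x. (1 - t) * a x + t * h x)"
      unfolding a_def using isotonic_regression_le[OF A w] by blast
    also have "\<dots> = weighted_sq_loss A w \<theta> a + t * (t * Q - 2 * S)"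
      unfolding weighted_sq_loss_def Q_def S_def sum_distrib_left sum_subtractf[symmetric] sum.distrib[symmetric]
      by (intro sum.cong refl) (simp add: power2_eq_square algebra_simps)
    finally have "0 \<le> t * (t * Q - 2 * S)" by simp
    then show ?thesis using t by (simp add: zero_le_mult_iff)
  qed
  have "((\<lambda>t. t * Q) \<longlongrightarrow> 0 * Q) (at_right 0)"
    by (intro tendsto_intros)
  moreover have "eventually (\<lambda>t. 2 * S \<le> t * Q) (at_right (0::real))"
    using le eventually_at_right_less[of "0::real"]
    by (auto simp: eventually_at_right[of 0 1] intro: exI[of _ 1])
  ultimately have "2 * S \<le> 0 * Q"
    by (intro tendsto_lowerbound) auto
  then show ?thesis by (simp add: S_def)
qed

text \<open>Add the variational inequalities of both regressions, tested against each other, and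
  absorb the cross term by the inequality of arithmetic and geometric means.\<close>

lemma isotonic_regression_stability:
  fixes A :: "'i::order set" and \<theta> \<theta>' :: "'i \<Rightarrow> real"
  assumes A: "finite A" and w: "\<forall>x\<in>A. 0 < w x" and w': "\<forall>x\<in>A. 0 < w' x"
  defines "a \<equiv> isotonic_regression A w \<theta>" and "b \<equiv> isotonic_regression A w' \<theta>'"
  shows "weighted_sq_loss A w' a b \<le> (\<Sum>x\<in>A. (w' x * (\<theta>' x - a x) - w x * (\<theta> x - a x))\<^sup>2 / w' x)"
proof -
  \<comment> \<open>Up to a constant factor, \<open>c\<close> is the change of the gradient of the
    loss at \<open>a\<close> when weights and data are replaced.\<close>
  define c where "c x = w' x * (\<theta>' x - a x) - w x * (\<theta> x - a x)" for x
  have "(\<Sum>x\<in>A. w x * (\<theta> x - a x) * (b x - a x)) \<le> 0"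
    unfolding a_def b_def
    by (intro isotonic_regression_variational[OF A w] isotonic_regression_mono[OF A w'])
  moreover have "(\<Sum>x\<in>A. w' x * (\<theta>' x - b x) * (a x - b x)) \<le> 0"
    unfolding a_def b_def
    by (intro isotonic_regression_variational[OF A w'] isotonic_regression_mono[OF A w])
  moreover have "weighted_sq_loss A w' a b = (\<Sum>x\<in>A. c x * (b x - a x)) +
      (\<Sum>x\<in>A. w x * (\<theta> x - a x) * (b x - a x)) + (\<Sum>x\<in>A. w' x * (\<theta>' x - b x) * (a x - b x))"
    unfolding weighted_sq_loss_def sum.distrib[symmetric]
    by (intro sum.cong refl) (simp add: c_def power2_eq_square algebra_simps)
  ultimately have "weighted_sq_loss A w' a b \<le> (\<Sum>x\<in>A. c x * (b x - a x))"
    by linarith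
  also have "\<dots> \<le> (\<Sum>x\<in>A. ((c x)\<^sup>2 / w' x + (b x - a x)\<^sup>2 * w' x) / 2)"
  proof (rule sum_mono)
    fix x assume "x \<in> A"
    then have p: "0 < w' x" using w' by blast
    have "0 \<le> (c x - w' x * (b x - a x))\<^sup>2 / w' x"
      using p by simp
    also have "\<dots> = (c x)\<^sup>2 / w' x + (b x - a x)\<^sup>2 * w' x - 2 * (c x * (b x - a x))"
      using p by (simp add: power2_eq_square field_simps)
    finally show "c x * (b x - a x) \<le> ((c x)\<^sup>2 / w' x + (b x - a x)\<^sup>2 * w' x) / 2"
      by simp
  qed
  also have "\<dots> = ((\<Sum>x\<in>A. (c x)\<^sup>2 / w' x) + weighted_sq_loss A w' a b) / 2"
    by (simp add: weighted_sq_loss_def sum.distrib flip: sum_divide_distrib)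
  finally show ?thesis by (simp add: c_def)
qed

text \<open>The stability bound contains only the regression of the limiting data, which is fixed,
  so its limit can be computed termwise. The weights \<open>wn n\<close> are positive only from some
  index on.\<close>

lemma isotonic_regression_tendsto:
  fixes A :: "'i::order set"
  assumes A: "finite A" and w: "\<forall>x\<in>A. 0 < w x"
    and wn: "\<forall>x\<in>A. (\<lambda>n. wn n x) \<longlonglongrightarrow> w x"
    and \<theta>n: "\<forall>x\<in>A. (\<lambda>n. \<theta>n n x) \<longlonglongrightarrow> \<theta> x"
    and x: "x \<in> A"
  shows "(\<lambda>n. isotonic_regression A (wn n) (\<theta>n n) x) \<longlonglongrightarrow> isotonic_regression A w \<theta> x"
proof -
  define a where "a = isotonic_regression A w \<theta>"
  define b where "b n = isotonic_regression A (wn n) (\<theta>n n)" for n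
  \<comment> \<open>The stability bound, divided by the weight at \<open>x\<close> so that it
    controls the squared error at that point.\<close>
  define R where "R n = (\<Sum>x\<in>A. (wn n x * (\<theta>n n x - a x) - w x * (\<theta> x - a x))\<^sup>2 / wn n x) / wn n x" for n
  have pos: "eventually (\<lambda>n. \<forall>x\<in>A. 0 < wn n x) sequentially"
    using A w wn by (auto simp: eventually_ball_finite_distrib intro!: order_tendstoD)
  have le: "eventually (\<lambda>n. (b n x - a x)\<^sup>2 \<le> R n) sequentially"
    using pos
  proof eventually_elim
    case (elim n)
    then have p: "\<forall>x\<in>A. 0 < wn n x" by blast
    have "(b n x - a x)\<^sup>2 * wn n x \<le> weighted_sq_loss A (wn n) a (b n)"
      by (rule weighted_sq_loss_term_le[OF A p x])
    also have "\<dots> \<le> (\<Sum>x\<in>A. (wn n x * (\<theta>n n x - a x) - w x * (\<theta> x - a x))\<^sup>2 / wn n x)"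
      unfolding a_def b_def by (rule isotonic_regression_stability[OF A w p])
    finally show ?case
      using bspec[OF p x] by (simp add: R_def field_simps)
  qed
  have w_neq: "w x \<noteq> 0" if "x \<in> A" for x
    using bspec[OF w that] by simp
  have "R \<longlonglongrightarrow> (\<Sum>x\<in>A. (w x * (\<theta> x - a x) - w x * (\<theta> x - a x))\<^sup>2 / w x) / w x"
    unfolding R_def using x
    by (intro tendsto_intros wn[rule_format] \<theta>n[rule_format] w_neq)
  then have "R \<longlonglongrightarrow> 0" by simp
  from tendsto_sandwich[OF _ le tendsto_const this]
  have "(\<lambda>n. (b n x - a x)\<^sup>2) \<longlonglongrightarrow> 0" by simp
  then have "(\<lambda>n. b n x - a x) \<longlonglongrightarrow> 0"
    using tendsto_real_sqrt[of "\<lambda>n. (b n x - a x)\<^sup>2" 0 sequentially] by (simp add: tendsto_rabs_zero_iff)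
  then show ?thesis
    unfolding a_def b_def by (rule LIM_zero_cancel)
qed

subsection \<open>Localization at the comparable level sets\<close>

lemma comparable_level_set_subset:
  assumes "x \<in> I" shows "comparable_level_set I g x \<subseteq> {z \<in> I. g z = g x}"
proof
  fix y assume "y \<in> comparable_level_set I g x"
  then have "(x, y) \<in> (comparability_edges {z \<in> I. g z = g x})\<^sup>*"
    by (simp add: comparable_level_set_def)
  then show "y \<in> {z \<in> I. g z = g x}"
    using assms by (induction) (auto simp: comparability_edges_def)
qed

lemma self_in_comparable_level_set [simp]: "x \<in> comparable_level_set I g x"
  by (simp add: comparable_level_set_def)

text \<open>The edges are symmetric, so reachability is an equivalence relation, and
  \<open>g y = g x\<close> makes both edge relations the same.\<close>

lemma comparable_level_set_eq:
  assumes x: "x \<in> I" and y: "y \<in> comparable_level_set I g x"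
  shows "comparable_level_set I g y = comparable_level_set I g x"
proof -
  let ?E = "comparability_edges {z \<in> I. g z = g x}"
  have "g y = g x" using comparable_level_set_subset[OF x] y by auto
  moreover have xy: "(x, y) \<in> ?E\<^sup>*" using y by (simp add: comparable_level_set_def)
  moreover have "sym ?E" by (auto simp: sym_def comparability_edges_def)
  then have "(y, x) \<in> ?E\<^sup>*" using xy by (meson symD sym_rtrancl)
  ultimately show ?thesis
    unfolding comparable_level_set_def by (auto intro: rtrancl_trans)
qed

lemma comparable_in_comparable_level_set:
  assumes "x \<in> I" "y \<in> I" "g x = g y" "x \<le> y"
  shows "y \<in> comparable_level_set I g x"
  using assms by (auto simp: comparable_level_set_def comparability_edges_def)

text \<open>Group the points by their component: the fibre of
  \<open>comparable_level_set I g\<close> over a component \<open>C\<close> is \<open>C\<close>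
  itself.\<close>

lemma sum_comparable_level_sets:
  assumes I: "finite I"
  shows "(\<Sum>x\<in>I. F x) = (\<Sum>C\<in>comparable_level_set I g ` I. \<Sum>x\<in>C. F x)"
proof -
  have "(\<Sum>x\<in>I. F x) =
      (\<Sum>C\<in>comparable_level_set I g ` I. \<Sum>x\<in>{x \<in> I. comparable_level_set I g x = C}. F x)"
    using I by (intro sum.group[symmetric]) auto
  also have "\<dots> = (\<Sum>C\<in>comparable_level_set I g ` I. \<Sum>x\<in>C. F x)"
  proof (intro sum.cong refl)
    fix C assume "C \<in> comparable_level_set I g ` I"
    then obtain y where y: "y \<in> I" "C = comparable_level_set I g y" by auto
    show "{x \<in> I. comparable_level_set I g x = C} = C"
      using comparable_level_set_eq[OF y(1), of _ g] comparable_level_set_subset[OF y(1), of g]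
        self_in_comparable_level_set[of _ I g] y by blast
  qed
  finally show ?thesis .
qed

text \<open>The glued function minimizes the loss on each component even among functions that are
  isotonic only there. Hence it is optimal on \<open>I\<close> as soon as it is feasible, which is
  the hypothesis \<open>mono\<close>.\<close>

lemma isotonic_regression_eq_levelwise:
  fixes I :: "'i::order set"
  assumes I: "finite I" and w: "\<forall>x\<in>I. 0 < w x"
    and mono: "mono_on I (\<lambda>x. g x + levelwise_isotonic_regression I g w \<theta> x)"
    and x: "x \<in> I"
  shows "isotonic_regression I w (\<lambda>x. g x + \<theta> x) x = g x + levelwise_isotonic_regression I g w \<theta> x"
proof (rule isotonic_regression_eqI[of I w "\<lambda>x. g x + levelwise_isotonic_regression I g w \<theta> x", OF I w mono _ x])
  fix h :: "'i \<Rightarrow> real" assume h: "mono_on I h"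
  let ?l = "levelwise_isotonic_regression I g w \<theta>" and ?K = "comparable_level_set I g ` I"
  have *: "weighted_sq_loss C w (\<lambda>x. g x + \<theta> x) (\<lambda>x. g x + ?l x) \<le> weighted_sq_loss C w (\<lambda>x. g x + \<theta> x) h"
    if K: "C \<in> ?K" for C
  proof -
    obtain y where y: "y \<in> I" "C = comparable_level_set I g y" using K by auto
    have C: "C \<subseteq> I" "\<And>z. z \<in> C \<Longrightarrow> g z = g y"
      using comparable_level_set_subset[OF y(1), of g] y(2) by auto
    have "?l z = isotonic_regression C w \<theta> z" if "z \<in> C" for z
      using that C comparable_level_set_eq[OF y(1), of z g] y(2)
      by (auto simp: levelwise_isotonic_regression_def)
    then have "weighted_sq_loss C w (\<lambda>x. g x + \<theta> x) (\<lambda>x. g x + ?l x) =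
        weighted_sq_loss C w \<theta> (isotonic_regression C w \<theta>)"
      by (intro weighted_sq_loss_cong) auto
    \<comment> \<open>Since \<open>g\<close> is constant on \<open>C\<close>, subtracting it keeps
      \<open>h\<close> isotonic on \<open>C\<close>.\<close>
    also have "\<dots> \<le> weighted_sq_loss C w \<theta> (\<lambda>x. h x - g x)"
      using C h w finite_subset[OF C(1) I]
      by (intro isotonic_regression_le) (auto simp: monotone_on_def subset_iff)
    also have "\<dots> = weighted_sq_loss C w (\<lambda>x. g x + \<theta> x) h"
      by (intro weighted_sq_loss_cong) auto
    finally show ?thesis .
  qed
  then show "weighted_sq_loss I w (\<lambda>x. g x + \<theta> x) (\<lambda>x. g x + ?l x) \<le> weighted_sq_loss I w (\<lambda>x. g x + \<theta> x) h"
    unfolding weighted_sq_loss_def sum_comparable_level_sets[OF I, where g = g] by (rule sum_mono)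
qed

lemma levelwise_isotonic_regression_tendsto:
  fixes I :: "'i::order set"
  assumes I: "finite I" and w: "\<forall>x\<in>I. 0 < w x"
    and wn: "\<forall>x\<in>I. (\<lambda>n. wn n x) \<longlonglongrightarrow> w x"
    and \<theta>n: "\<forall>x\<in>I. (\<lambda>n. \<theta>n n x) \<longlonglongrightarrow> \<theta> x"
    and x: "x \<in> I"
  shows "(\<lambda>n. levelwise_isotonic_regression I g (wn n) (\<theta>n n) x)
    \<longlonglongrightarrow> levelwise_isotonic_regression I g w \<theta> x"
proof -
  have "comparable_level_set I g x \<subseteq> I" using comparable_level_set_subset[OF x, of g] by auto
  then show ?thesis
    using assms finite_subset[of _ I]
    by (simp add: levelwise_isotonic_regression_def subset_iff isotonic_regression_tendsto)
qed

lemma levelwise_isotonic_regression_scale: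
  fixes I :: "'i::order set"
  assumes I: "finite I" and w: "\<forall>x\<in>I. 0 < w x" and c: "0 < c" and x: "x \<in> I"
  shows "levelwise_isotonic_regression I g w (\<lambda>x. c * \<theta> x) x = c * levelwise_isotonic_regression I g w \<theta> x"
proof -
  have "comparable_level_set I g x \<subseteq> I" using comparable_level_set_subset[OF x, of g] by auto
  then show ?thesis
    using assms finite_subset[of _ I]
    by (simp add: levelwise_isotonic_regression_def subset_iff isotonic_regression_scale)
qed

text \<open>Across different level sets \<open>g\<close> has a positive gap, so a perturbation of size
  \<open>1 / c n\<close> is eventually too small to violate monotonicity there.\<close>

lemma isotonic_regression_rescaled_tendsto:
  fixes I :: "'i::order set"
  assumes I: "finite I" and g: "mono_on I g" and w: "\<forall>x\<in>I. 0 < w x"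
    and wn: "\<forall>x\<in>I. (\<lambda>n. wn n x) \<longlonglongrightarrow> w x"
    and zn: "\<forall>x\<in>I. (\<lambda>n. zn n x) \<longlonglongrightarrow> z x"
    and c: "filterlim c at_top sequentially"
    and x: "x \<in> I"
  shows "(\<lambda>n. c n * (isotonic_regression I (wn n) (\<lambda>x. g x + zn n x / c n) x - g x))
    \<longlonglongrightarrow> levelwise_isotonic_regression I g w z x"
proof -
  let ?l = "\<lambda>n. levelwise_isotonic_regression I g (wn n) (zn n)"
  have lim: "(\<lambda>n. ?l n x) \<longlonglongrightarrow> levelwise_isotonic_regression I g w z x" if "x \<in> I" for x
    by (rule levelwise_isotonic_regression_tendsto[OF I w wn zn that])
  have pos: "eventually (\<lambda>n. \<forall>x\<in>I. 0 < wn n x) sequentially"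
    using I w wn by (auto simp: eventually_ball_finite_distrib intro!: order_tendstoD)
  have cpos: "eventually (\<lambda>n. 0 < c n) sequentially"
    using c by (simp add: filterlim_at_top_dense)
  \<comment> \<open>The numerator converges and \<open>c\<close> diverges, so the correction to
    \<open>g\<close> vanishes.\<close>
  have lim0: "(\<lambda>n. g x + ?l n x / c n) \<longlonglongrightarrow> g x + 0" if "x \<in> I" for x
    using real_tendsto_divide_at_top[OF lim[OF that] c] by (intro tendsto_intros)
  have gap: "eventually (\<lambda>n. g x + ?l n x / c n < g y + ?l n y / c n) sequentially"
    if xy: "x \<in> I" "y \<in> I" "g x < g y" for x y
  proof -
    obtain m where m: "g x < m" "m < g y" using dense[OF xy(3)] by auto
    have "eventually (\<lambda>n. g x + ?l n x / c n < m) sequentially"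
      using lim0[OF xy(1)] m by (intro order_tendstoD) auto
    moreover have "eventually (\<lambda>n. m < g y + ?l n y / c n) sequentially"
      using lim0[OF xy(2)] m by (intro order_tendstoD(1)[OF lim0[OF xy(2)]]) auto
    ultimately show ?thesis by eventually_elim linarith
  qed
  have "eventually (\<lambda>n. \<forall>x\<in>I. \<forall>y\<in>I. g x < g y \<longrightarrow> g x + ?l n x / c n < g y + ?l n y / c n) sequentially"
    using I gap by (simp add: eventually_ball_finite_distrib)
  with pos cpos have "eventually (\<lambda>n. ?l n x =
      c n * (isotonic_regression I (wn n) (\<lambda>x. g x + zn n x / c n) x - g x)) sequentially"
  proof eventually_elim
    case (elim n)
    then have p: "\<forall>x\<in>I. 0 < wn n x" and cn: "0 < c n" by auto
    let ?k = "levelwise_isotonic_regression I g (wn n) (\<lambda>x. zn n x / c n)"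
    have k: "?k x = ?l n x / c n" if "x \<in> I" for x
      using levelwise_isotonic_regression_scale[of I "wn n" "1 / c n" x g "zn n", OF I p _ that] cn by simp
    have "mono_on I (\<lambda>x. g x + ?k x)"
    proof (rule mono_onI)
      fix x y assume xy: "x \<in> I" "y \<in> I" "x \<le> y"
      then have "g x \<le> g y" using g by (auto simp: monotone_on_def)
      then consider "g x < g y" | "g x = g y" by linarith
      then show "g x + ?k x \<le> g y + ?k y"
      proof cases
        case 1 then show ?thesis using elim xy by (auto simp: k intro: less_imp_le)
      next
        case 2
        \<comment> \<open>Comparable points with equal \<open>g\<close> lie in one component, where
          the regression itself is isotonic.\<close>
        let ?C = "comparable_level_set I g x"
        have y: "y \<in> ?C" by (rule comparable_in_comparable_level_set) (use xy 2 in auto)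
        have C: "?C \<subseteq> I" using comparable_level_set_subset[OF xy(1), of g] by auto
        have "mono_on ?C (isotonic_regression ?C (wn n) (\<lambda>x. zn n x / c n))"
          using C p finite_subset[OF C I] by (intro isotonic_regression_mono) auto
        then show ?thesis
          using xy y 2 comparable_level_set_eq[OF xy(1) y]
          by (auto simp: levelwise_isotonic_regression_def monotone_on_def)
      qed
    qed
    from isotonic_regression_eq_levelwise[OF I p this x] show ?case
      using cn by (simp add: k[OF x])
  qed
  from Lim_transform_eventually[OF lim[OF x] this] show ?thesis .
qed

subsection \<open>Measurability and weak convergence on finite products\<close>

text \<open>Countability of the index type makes sequential continuity imply continuity on the full
  function space, and lets measurability into that space be checked by coordinates. Points of the
  product over \<open>I\<close> are moved there by extending them with 0.\<close>

lemma borel_measurable_PiM_sequentially_continuous: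
  fixes F :: "('i::countable \<Rightarrow> real) \<Rightarrow> real"
  assumes F: "\<And>zn z. (\<And>x. x \<in> I \<Longrightarrow> (\<lambda>n. zn n x) \<longlonglongrightarrow> z x) \<Longrightarrow> (\<lambda>n. F (zn n)) \<longlonglongrightarrow> F z"
  shows "F \<in> borel_measurable (\<Pi>\<^sub>M x\<in>I. borel)"
proof -
  have "continuous_on UNIV F"
  proof (rule continuous_on_sequentiallyI)
    fix zn :: "nat \<Rightarrow> 'i \<Rightarrow> real" and z assume lim: "zn \<longlonglongrightarrow> z"
    have "(\<lambda>n. zn n x) \<longlonglongrightarrow> z x" for x
    proof -
      have "continuous_on UNIV (\<lambda>z :: 'i \<Rightarrow> real. z x)"
        by (rule continuous_on_product_then_coordinatewise) (rule continuous_on_id)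
      from continuous_on_tendsto_compose[OF this lim] show ?thesis by simp
    qed
    then show "(\<lambda>n. F (zn n)) \<longlonglongrightarrow> F z" by (rule F)
  qed
  then have [measurable]: "F \<in> borel_measurable borel"
    by (rule borel_measurable_continuous_onI)
  have [measurable]: "(\<lambda>z x. if x \<in> I then z x else 0 :: real) \<in> borel_measurable (\<Pi>\<^sub>M x\<in>I. borel)"
  proof (rule measurable_coordinatewise_then_product)
    show "(\<lambda>z. if x \<in> I then z x else 0 :: real) \<in> borel_measurable (\<Pi>\<^sub>M x\<in>I. borel)" for x
      by (cases "x \<in> I") auto
  qed
  \<comment> \<open>The hypothesis for the constant sequence \<open>z\<close>, which converges on
    \<open>I\<close> to the truncated \<open>z\<close>, shows that \<open>F\<close> depends only on
    the coordinates in \<open>I\<close>.\<close>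
  have "F z = F (\<lambda>x. if x \<in> I then z x else 0)" for z
    using F[of "\<lambda>_. z" "\<lambda>x. if x \<in> I then z x else 0"] by (simp add: LIMSEQ_const_iff)
  then have "F = (\<lambda>z. F (\<lambda>x. if x \<in> I then z x else 0))" by blast
  moreover have "(\<lambda>z. F (\<lambda>x. if x \<in> I then z x else 0)) \<in> borel_measurable (\<Pi>\<^sub>M x\<in>I. borel)"
    by measurable
  ultimately show ?thesis by simp
qed

lemma continuous_map_powertop_real_tendsto:
  assumes f: "continuous_map (powertop_real I) euclideanreal f"
    and lim: "\<And>x. x \<in> I \<Longrightarrow> (\<lambda>n. zn n x) \<longlonglongrightarrow> z x"
  shows "(\<lambda>n. f (restrict (zn n) I)) \<longlonglongrightarrow> f (restrict z I)"
proof -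
  have "limitin (powertop_real I) (\<lambda>n. restrict (zn n) I) (restrict z I) sequentially"
    using lim by (auto simp: limitin_componentwise)
  from continuous_map_limit[OF f this] show ?thesis
    by (simp add: o_def)
qed

text \<open>Continuity of \<open>f\<close> concerns extensional arguments only, so \<open>f\<close>
  is first composed with \<open>restrict\<close>, which is the identity on the space of the
  product.\<close>

lemma continuous_map_powertop_real_measurable:
  fixes f :: "('i::countable \<Rightarrow> real) \<Rightarrow> real"
  assumes f: "continuous_map (powertop_real I) euclideanreal f"
  shows "f \<in> borel_measurable (\<Pi>\<^sub>M x\<in>I. borel)"
proof -
  have "(\<lambda>z. f (restrict z I)) \<in> borel_measurable (\<Pi>\<^sub>M x\<in>I. borel)"
    by (intro borel_measurable_PiM_sequentially_continuous continuous_map_powertop_real_tendsto[OF f])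
  moreover have "f (restrict z I) = f z" if "z \<in> space (\<Pi>\<^sub>M x\<in>I. borel)" for z
    using that by (simp add: space_PiM PiE_def extensional_restrict)
  ultimately show ?thesis
    by (simp cong: measurable_cong)
qed

lemma weak_conv_vec_pointwise:
  fixes I :: "'i::countable set"
  assumes P: "prob_space P"
    and T: "eventually (\<lambda>n. T n \<in> P \<rightarrow>\<^sub>M (\<Pi>\<^sub>M x\<in>I. borel) \<and> \<mu> n = distr P (\<Pi>\<^sub>M x\<in>I. borel) (T n)) sequentially"
    and T': "T' \<in> P \<rightarrow>\<^sub>M (\<Pi>\<^sub>M x\<in>I. borel)" "\<nu> = distr P (\<Pi>\<^sub>M x\<in>I. borel) T'"
    and lim: "\<And>u x. u \<in> space P \<Longrightarrow> x \<in> I \<Longrightarrow> (\<lambda>n. T n u x) \<longlonglongrightarrow> T' u x"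
  shows "weak_conv_vec I \<mu> \<nu>"
  unfolding weak_conv_vec_def
proof (intro allI impI, elim conjE)
  fix f assume f: "continuous_map (powertop_real I) euclideanreal f"
    and "bounded (f ` topspace (powertop_real I))"
  then obtain B where B: "\<And>z. z \<in> extensional I \<Longrightarrow> norm (f z) \<le> B"
    by (auto simp: bounded_iff PiE_def)
  interpret prob_space P by fact
  note [measurable] = continuous_map_powertop_real_measurable[OF f] T'(1)
  \<comment> \<open>Beyond \<open>n0\<close> every \<open>T n\<close> is measurable and represents
    \<open>\<mu> n\<close>; the shift by \<open>n0\<close> does not change the limit.\<close>
  obtain n0 where "\<And>n. n \<ge> n0 \<Longrightarrow> T n \<in> P \<rightarrow>\<^sub>M (\<Pi>\<^sub>M x\<in>I. borel) \<and> \<mu> n = distr P (\<Pi>\<^sub>M x\<in>I. borel) (T n)"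
    using T by (auto simp: eventually_sequentially)
  then have [measurable]: "T (n + n0) \<in> P \<rightarrow>\<^sub>M (\<Pi>\<^sub>M x\<in>I. borel)"
    and \<mu>: "\<mu> (n + n0) = distr P (\<Pi>\<^sub>M x\<in>I. borel) (T (n + n0))" for n
    by auto
  have ext: "S u \<in> extensional I" if "S \<in> P \<rightarrow>\<^sub>M (\<Pi>\<^sub>M x\<in>I. (borel :: real measure))" "u \<in> space P" for S u
    using measurable_space[OF that] by (auto simp: space_PiM PiE_def)
  have "(\<lambda>n. \<integral>u. f (T (n + n0) u) \<partial>P) \<longlonglongrightarrow> (\<integral>u. f (T' u) \<partial>P)"
  proof (rule integral_dominated_convergence[where w = "\<lambda>_. B"])
    show "AE u in P. (\<lambda>n. f (T (n + n0) u)) \<longlonglongrightarrow> f (T' u)"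
    proof (rule AE_I2)
      fix u assume u: "u \<in> space P"
      have "(\<lambda>n. f (restrict (T (n + n0) u) I)) \<longlonglongrightarrow> f (restrict (T' u) I)"
        using lim[OF u] by (intro continuous_map_powertop_real_tendsto[OF f] LIMSEQ_ignore_initial_segment)
      then show "(\<lambda>n. f (T (n + n0) u)) \<longlonglongrightarrow> f (T' u)"
        using ext[OF _ u] T'(1) by (simp add: extensional_restrict)
    qed
    show "AE u in P. norm (f (T (n + n0) u)) \<le> B" for n
      by (intro AE_I2 B ext) auto
  qed auto
  then have "(\<lambda>n. \<integral>z. f z \<partial>\<mu> (n + n0)) \<longlonglongrightarrow> (\<integral>z. f z \<partial>\<nu>)"
    by (simp add: \<mu> T'(2) integral_distr)
  then show "(\<lambda>n. \<integral>z. f z \<partial>\<mu> n) \<longlonglongrightarrow> (\<integral>z. f z \<partial>\<nu>)"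
    by (rule LIMSEQ_offset)
qed

text \<open>A finite product measure is determined by its values on boxes, and the preimage of a box
  under a coordinatewise map is a box.\<close>

lemma distr_PiM_componentwise:
  assumes I: "finite I" and M: "\<And>i. prob_space (M i)"
    and f[measurable]: "\<And>i. f i \<in> M i \<rightarrow>\<^sub>M N i"
  shows "distr (\<Pi>\<^sub>M i\<in>I. M i) (\<Pi>\<^sub>M i\<in>I. N i) (\<lambda>z. \<lambda>i\<in>I. f i (z i)) = (\<Pi>\<^sub>M i\<in>I. distr (M i) (N i) (f i))"
proof -
  interpret M: product_prob_space M I by (intro product_prob_spaceI M)
  interpret D: product_prob_space "\<lambda>i. distr (M i) (N i) (f i)" I
    by (intro product_prob_spaceI prob_space.prob_space_distr M f)
  show ?thesis
  proof (rule D.PiM_eqI[OF I])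
    show "sets (distr (\<Pi>\<^sub>M i\<in>I. M i) (\<Pi>\<^sub>M i\<in>I. N i) (\<lambda>z. \<lambda>i\<in>I. f i (z i)))
        = sets (\<Pi>\<^sub>M i\<in>I. distr (M i) (N i) (f i))"
      by (simp cong: sets_PiM_cong)
    fix A assume "\<And>i. i \<in> I \<Longrightarrow> A i \<in> sets (distr (M i) (N i) (f i))"
    then have A: "\<And>i. i \<in> I \<Longrightarrow> A i \<in> sets (N i)" by simp
    have vimage: "(\<lambda>z. \<lambda>i\<in>I. f i (z i)) -` Pi\<^sub>E I A \<inter> space (\<Pi>\<^sub>M i\<in>I. M i)
        = (\<Pi>\<^sub>E i\<in>I. f i -` A i \<inter> space (M i))"
      by (auto simp: space_PiM PiE_iff extensional_def restrict_def)
    have "emeasure (distr (\<Pi>\<^sub>M i\<in>I. M i) (\<Pi>\<^sub>M i\<in>I. N i) (\<lambda>z. \<lambda>i\<in>I. f i (z i))) (Pi\<^sub>E I A)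
        = emeasure (\<Pi>\<^sub>M i\<in>I. M i) (\<Pi>\<^sub>E i\<in>I. f i -` A i \<inter> space (M i))"
      using A I by (subst emeasure_distr) (auto simp: vimage intro!: sets_PiM_I_finite)
    also have "\<dots> = (\<Prod>i\<in>I. emeasure (M i) (f i -` A i \<inter> space (M i)))"
      using A by (intro M.emeasure_PiM I) (auto intro: measurable_sets[OF f])
    also have "\<dots> = (\<Prod>i\<in>I. emeasure (distr (M i) (N i) (f i)) (A i))"
      using A by (intro prod.cong refl) (simp add: emeasure_distr)
    finally show "emeasure (distr (\<Pi>\<^sub>M i\<in>I. M i) (\<Pi>\<^sub>M i\<in>I. N i) (\<lambda>z. \<lambda>i\<in>I. f i (z i))) (Pi\<^sub>E I A)
        = (\<Prod>i\<in>I. emeasure (distr (M i) (N i) (f i)) (A i))" .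
  qed
qed

subsection \<open>Sums of independent identically distributed variables\<close>

text \<open>The characteristic function of the sum is a power of the common one, with the number of
  summands as exponent. This allows a cell to be replaced by an initial segment of indices.\<close>

lemma (in prob_space) distr_iid_sum_card_cong:
  fixes X :: "'i \<Rightarrow> 'a \<Rightarrow> real"
  assumes indep: "indep_vars (\<lambda>_. borel) X K"
    and ident: "\<And>i j. i \<in> K \<Longrightarrow> j \<in> K \<Longrightarrow> distr M borel (X i) = distr M borel (X j)"
    and J: "finite J" "J \<subseteq> K" "finite J'" "J' \<subseteq> K" "card J = card J'"
  shows "distr M borel (\<lambda>\<omega>. \<Sum>i\<in>J. X i \<omega>) = distr M borel (\<lambda>\<omega>. \<Sum>i\<in>J'. X i \<omega>)"
\<comment> \<open>A nonempty \<open>J\<close> supplies an index \<open>k\<close> that names the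
  common law; otherwise both sums are empty.\<close>
proof (cases "J = {}")
  case True
  then show ?thesis using J by simp
next
  case False
  then obtain k where k: "k \<in> K" using J by auto
  have rv: "random_variable borel (X i)" if "i \<in> K" for i
    using indep that by (auto simp: indep_vars_def)
  have char: "char (distr M borel (\<lambda>\<omega>. \<Sum>i\<in>L. X i \<omega>)) t = char (distr M borel (X k)) t ^ card L"
    if "L \<subseteq> K" for L t
  proof -
    have "char (distr M borel (\<lambda>\<omega>. \<Sum>i\<in>L. X i \<omega>)) t = (\<Prod>i\<in>L. char (distr M borel (X i)) t)"
      by (rule char_distr_sum[OF indep_vars_subset[OF indep that]])
    also have "\<dots> = (\<Prod>i\<in>L. char (distr M borel (X k)) t)"
      using that ident[OF _ k] by (intro prod.cong) auto
    finally show ?thesis by simp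
  qed
  show ?thesis
  proof (rule Levy_uniqueness)
    show "real_distribution (distr M borel (\<lambda>\<omega>. \<Sum>i\<in>J. X i \<omega>))"
      using J rv by (intro real_distribution_distr borel_measurable_sum) auto
    show "real_distribution (distr M borel (\<lambda>\<omega>. \<Sum>i\<in>J'. X i \<omega>))"
      using J rv by (intro real_distribution_distr borel_measurable_sum) auto
  qed (use J in \<open>auto simp: char\<close>)
qed

text \<open>The central limit theorem in the almost sure form supplied by Skorohod's theorem; the
  library theorem excludes \<open>\<sigma> = 0\<close>.\<close>

lemma (in prob_space) central_limit_theorem_Skorohod:
  fixes X :: "nat \<Rightarrow> 'a \<Rightarrow> real"
  assumes indep: "indep_vars (\<lambda>_. borel) X {1..}"
    and ident: "\<And>i j. i \<ge> 1 \<Longrightarrow> j \<ge> 1 \<Longrightarrow> distr M borel (X i) = distr M borel (X j)"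
    and square_int: "\<And>i. i \<ge> 1 \<Longrightarrow> integrable M (\<lambda>\<omega>. (X i \<omega>)\<^sup>2)"
    and mean: "\<And>i. i \<ge> 1 \<Longrightarrow> expectation (X i) = 0"
    and var: "\<And>i. i \<ge> 1 \<Longrightarrow> variance (X i) = \<sigma>\<^sup>2"
  shows "\<exists>(\<Omega> :: real measure) U V. prob_space \<Omega> \<and> (\<forall>n. U n \<in> borel_measurable \<Omega>) \<and>
    (\<forall>n. distr \<Omega> borel (U n) = distr M borel (\<lambda>\<omega>. (\<Sum>i=1..n. X i \<omega>) / sqrt (real n))) \<and>
    V \<in> borel_measurable \<Omega> \<and> distr \<Omega> borel V = normal_law 0 (\<sigma>\<^sup>2) \<and>
    (\<forall>u\<in>space \<Omega>. (\<lambda>n. U n u) \<longlonglongrightarrow> V u)"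
proof -
  have rv[measurable]: "random_variable borel (X i)" if "i \<ge> 1" for i
    using indep that by (auto simp: indep_vars_def)
  have rv_Suc[measurable]: "random_variable borel (X (Suc i))" for i
    by (rule rv) simp
  have sum_Suc: "(\<Sum>i=1..n. X i \<omega>) = (\<Sum>i<n. X (Suc i) \<omega>)" for n \<omega>
    using sum.atLeast1_atMost_eq[of "\<lambda>i. X i \<omega>" n] by simp
  interpret N: real_distribution std_normal_distribution by (rule real_dist_normal_dist)
  show ?thesis
  proof (cases "\<sigma> = 0")
    case True
    have "AE \<omega> in M. X (Suc i) \<omega> = 0" for i
    proof -
      have "(\<integral>\<omega>. (X (Suc i) \<omega>)\<^sup>2 \<partial>M) = 0"
        using var[of "Suc i"] mean[of "Suc i"] True by simp
      then have "AE \<omega> in M. (X (Suc i) \<omega>)\<^sup>2 = 0"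
        using square_int[of "Suc i"] by (subst (asm) integral_nonneg_eq_0_iff_AE) auto
      then show ?thesis by simp
    qed
    then have "AE \<omega> in M. \<forall>i. X (Suc i) \<omega> = 0"
      by (simp add: AE_all_countable)
    then have "distr M borel (\<lambda>\<omega>. (\<Sum>i=1..n. X i \<omega>) / sqrt (real n)) = distr M borel (\<lambda>_. 0)" for n
      unfolding sum_Suc by (intro distr_cong_AE) auto
    \<comment> \<open>All variables vanish almost surely, so the constant 0 on any probability space
      over the reals serves; the normal distribution is just such a space.\<close>
    then show ?thesis
      using True N.prob_space_axioms
      by (intro exI[of _ std_normal_distribution] exI[of _ "\<lambda>_ _. 0"] exI[of _ "\<lambda>_. 0"])
        (simp add: normal_law_def)
  next
    case False
    \<comment> \<open>Only \<open>\<sigma>\<^sup>2\<close> is given, so \<open>\<sigma>\<close> may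
      be negative; the absolute value is the standard deviation.\<close>
    let ?\<mu> = "\<lambda>n. distr M borel (\<lambda>\<omega>. (\<Sum>i<n. X (Suc i) \<omega>) / sqrt (real n * \<bar>\<sigma>\<bar>\<^sup>2))"
    \<comment> \<open>Reindex from \<open>{1..}\<close> to all naturals by treating each singleton
      \<open>{Suc i}\<close> as a block.\<close>
    have "indep_vars (\<lambda>i. borel) (\<lambda>i \<omega>. restrict (\<lambda>j. X j \<omega>) {Suc i} (Suc i)) UNIV"
      by (rule indep_vars_compose2[OF indep_vars_restrict[OF indep, of UNIV "\<lambda>i. {Suc i}"],
            where Y = "\<lambda>i f. f (Suc i)"]) (auto simp: disjoint_family_on_def)
    then have indep_Suc: "indep_vars (\<lambda>i. borel) (\<lambda>i. X (Suc i)) UNIV"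
      by simp
    have "weak_conv_m ?\<mu> std_normal_distribution"
      using False
      by (intro central_limit_theorem_zero_mean[OF indep_Suc, where \<mu> = "distr M borel (X 1)"])
        (auto intro!: mean square_int ident simp: var)
    moreover have "real_distribution (?\<mu> n)" for n
      by (rule real_distribution_distr) measurable
    ultimately obtain \<Omega> :: "real measure" and U V where Skorohod:
      "prob_space \<Omega> \<and> (\<forall>n. U n \<in> borel_measurable \<Omega>) \<and> (\<forall>n. distr \<Omega> borel (U n) = ?\<mu> n) \<and>
       V \<in> \<Omega> \<rightarrow>\<^sub>M lborel \<and> distr \<Omega> borel V = std_normal_distribution \<and>
       (\<forall>u\<in>space \<Omega>. (\<lambda>n. U n u) \<longlonglongrightarrow> V u)"
      using Skorohod[of ?\<mu>, OF _ real_dist_normal_dist] by blast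
    then have \<Omega>: "prob_space \<Omega>"
      and [measurable]: "\<And>n. U n \<in> borel_measurable \<Omega>" "V \<in> borel_measurable \<Omega>"
      and U: "\<And>n. distr \<Omega> borel (U n) = ?\<mu> n" and V: "distr \<Omega> borel V = std_normal_distribution"
      and lim: "\<And>u. u \<in> space \<Omega> \<Longrightarrow> (\<lambda>n. U n u) \<longlonglongrightarrow> V u"
      by simp_all
    \<comment> \<open>Multiplying by the standard deviation undoes the normalization to variance
      1.\<close>
    have "distr \<Omega> borel (\<lambda>u. \<bar>\<sigma>\<bar> * U n u) = distr M borel (\<lambda>\<omega>. (\<Sum>i=1..n. X i \<omega>) / sqrt (real n))" for n
    proof -
      have "distr \<Omega> borel (\<lambda>u. \<bar>\<sigma>\<bar> * U n u) = distr (distr \<Omega> borel (U n)) borel (\<lambda>y. \<bar>\<sigma>\<bar> * y)"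
        by (simp add: distr_distr o_def)
      also have "\<dots> = distr M borel (\<lambda>\<omega>. (\<Sum>i=1..n. X i \<omega>) / sqrt (real n))"
        unfolding U sum_Suc using False by (simp add: distr_distr o_def real_sqrt_mult)
      finally show ?thesis .
    qed
    moreover have "distr \<Omega> borel (\<lambda>u. \<bar>\<sigma>\<bar> * V u) = normal_law 0 (\<sigma>\<^sup>2)"
    proof -
      have "distr \<Omega> borel (\<lambda>u. \<bar>\<sigma>\<bar> * V u) = distr (distr \<Omega> borel V) borel (\<lambda>y. \<bar>\<sigma>\<bar> * y)"
        by (simp add: distr_distr o_def)
      then show ?thesis by (simp add: V normal_law_def)
    qed
    ultimately show ?thesis
      using \<Omega> lim
      by (intro exI[of _ \<Omega>] exI[of _ "\<lambda>n u. \<bar>\<sigma>\<bar> * U n u"] exI[of _ "\<lambda>u. \<bar>\<sigma>\<bar> * V u"])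
        (auto intro!: tendsto_mult_left)
  qed
qed

lemma normal_law_divide_sqrt:
  "distr (normal_law 0 v) borel (\<lambda>y. y / sqrt w) = normal_law 0 (v / w)"
  by (simp add: normal_law_def distr_distr o_def real_sqrt_divide)

subsection \<open>The least squares estimator\<close>

lemma sum_of_bool_cell:
  "(\<Sum>i=1..n::nat. of_bool (d i = x)) = real (card ({1..n} \<inter> {i. d i = x}))"
  by simp

lemma design_weight_eq_card:
  "design_weight d n x = real (card ({1..n} \<inter> {i. d i = x})) / real n"
  unfolding design_weight_def sum_of_bool_cell ..

lemma cell_mean_eq_sum:
  "cell_mean d y n x = (\<Sum>i\<in>{1..n} \<inter> {i. d i = x}. y i) / real (card ({1..n} \<inter> {i. d i = x}))"
  unfolding cell_mean_def sum_of_bool_cell by simp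

text \<open>At fixed positive weights the regression is continuous in the data, hence
  measurable.\<close>

lemma isotonic_regression_PiM_measurable:
  fixes I :: "'i::{order,countable} set"
  assumes I: "finite I" and w: "\<forall>x\<in>I. 0 < w x"
  shows "(\<lambda>z. \<lambda>x\<in>I. c * (isotonic_regression I w (\<lambda>x. g x + z x / c) x - g x))
    \<in> (\<Pi>\<^sub>M x\<in>I. borel) \<rightarrow>\<^sub>M (\<Pi>\<^sub>M x\<in>I. borel)"
proof (rule measurable_restrict, rule borel_measurable_PiM_sequentially_continuous)
  fix x and zn :: "nat \<Rightarrow> 'i \<Rightarrow> real" and z
  assume x: "x \<in> I" and lim: "\<And>x. x \<in> I \<Longrightarrow> (\<lambda>n. zn n x) \<longlonglongrightarrow> z x"
  have "(\<lambda>n. isotonic_regression I w (\<lambda>x. g x + zn n x / c) x)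
      \<longlonglongrightarrow> isotonic_regression I w (\<lambda>x. g x + z x / c) x"
    \<comment> \<open>As a product with a constant, the quotient converges for every
      \<open>c\<close>, including 0.\<close>
    using x lim unfolding divide_inverse
    by (intro isotonic_regression_tendsto[OF I w, where wn = "\<lambda>_. w"]) (auto intro!: tendsto_intros)
  then show "(\<lambda>n. c * (isotonic_regression I w (\<lambda>x. g x + zn n x / c) x - g x))
      \<longlonglongrightarrow> c * (isotonic_regression I w (\<lambda>x. g x + z x / c) x - g x)"
    by (intro tendsto_intros)
qed

lemma levelwise_isotonic_regression_PiM_measurable:
  fixes I :: "'i::{order,countable} set"
  assumes I: "finite I" and w: "\<forall>x\<in>I. 0 < w x"
  shows "levelwise_isotonic_regression I g w \<in> (\<Pi>\<^sub>M x\<in>I. borel) \<rightarrow>\<^sub>M (\<Pi>\<^sub>M x\<in>I. borel)"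
proof -
  have "(\<lambda>z. \<lambda>x\<in>I. levelwise_isotonic_regression I g w z x) \<in> (\<Pi>\<^sub>M x\<in>I. borel) \<rightarrow>\<^sub>M (\<Pi>\<^sub>M x\<in>I. borel)"
    by (intro measurable_restrict borel_measurable_PiM_sequentially_continuous
        levelwise_isotonic_regression_tendsto[OF I w]) auto
  moreover have "(\<lambda>z. \<lambda>x\<in>I. levelwise_isotonic_regression I g w z x) = levelwise_isotonic_regression I g w"
    by (auto simp: levelwise_isotonic_regression_def fun_eq_iff)
  ultimately show ?thesis by simp
qed

text \<open>Stated for a finite subset of any countable partial order; \<open>theorem5\<close> is
  the instance on the grid.\<close>

lemma isotonic_lse_converges_in_distribution:
  fixes X :: "'i::{order,countable} set"
    and g w :: "'i \<Rightarrow> real"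
    and M :: "'a measure"
    and Y \<epsilon> :: "nat \<Rightarrow> 'a \<Rightarrow> real"
    and d :: "nat \<Rightarrow> 'i"
    and \<sigma> :: real
  assumes X: "finite X"
    and g: "mono_on X g"
    and M: "prob_space M"
    and design: "\<And>i. i \<ge> 1 \<Longrightarrow> d i \<in> X"
    and model: "\<And>i \<omega>. i \<ge> 1 \<Longrightarrow> \<omega> \<in> space M \<Longrightarrow> Y i \<omega> = g (d i) + \<epsilon> i \<omega>"
    and indep: "prob_space.indep_vars M (\<lambda>_. borel) \<epsilon> {1..}"
    and ident: "\<And>i j. i \<ge> 1 \<Longrightarrow> j \<ge> 1 \<Longrightarrow> distr M borel (\<epsilon> i) = distr M borel (\<epsilon> j)"
    and square_int: "\<And>i. i \<ge> 1 \<Longrightarrow> integrable M (\<lambda>\<omega>. (\<epsilon> i \<omega>)\<^sup>2)"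
    and mean: "\<And>i. i \<ge> 1 \<Longrightarrow> prob_space.expectation M (\<epsilon> i) = 0"
    and var: "\<And>i. i \<ge> 1 \<Longrightarrow> prob_space.variance M (\<epsilon> i) = \<sigma>\<^sup>2"
    and weights: "\<And>x. x \<in> X \<Longrightarrow> (\<lambda>n. design_weight d n x) \<longlonglongrightarrow> w x"
    and w_pos: "\<And>x. x \<in> X \<Longrightarrow> w x > 0"
  shows "converges_in_distribution M X
           (\<lambda>n \<omega> x. sqrt (real n) * (isotonic_lse X d (\<lambda>i. Y i \<omega>) n x - g x))
           (distr (centered_diag_gaussian X (\<lambda>x. \<sigma>\<^sup>2 / w x)) (\<Pi>\<^sub>M x\<in>X. borel)
              (levelwise_isotonic_regression X g w))"
proof -
  interpret prob_space M by fact
  let ?R = "\<Pi>\<^sub>M x\<in>X. (borel :: real measure)"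
  have X_ne: "X \<noteq> {}" using design[of 1] by auto
  have w: "\<forall>x\<in>X. 0 < w x" using w_pos by blast
  have sum_rv: "random_variable borel (\<lambda>\<omega>. \<Sum>i\<in>L. \<epsilon> i \<omega>)" if "L \<subseteq> {1..}" for L
    using indep that by (intro borel_measurable_sum) (auto simp: indep_vars_def)

  define J where "J n x = {1..n} \<inter> {i. d i = x}" for n x
  define N where "N n x = card (J n x)" for n x
  have weight: "design_weight d n x = real (N n x) / real n" for n x
    by (simp add: design_weight_eq_card N_def J_def)
  have J: "finite (J n x)" "J n x \<subseteq> {1..}" for n x
    by (auto simp: J_def)
  note [measurable] = sum_rv[OF J(2)]
  have [measurable]: "random_variable borel (\<lambda>\<omega>. \<Sum>i=1..n. \<epsilon> i \<omega>)" for n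
    by (rule sum_rv) auto
  have N_pos: "0 < N n x" "0 < n" if "0 < design_weight d n x" for n x
    using that by (auto simp: weight zero_less_divide_iff)
  have weight_pos: "eventually (\<lambda>n. \<forall>x\<in>X. 0 < design_weight d n x) sequentially"
    using X w_pos weights by (auto simp: eventually_ball_finite_distrib intro!: order_tendstoD)
  have N_top: "filterlim (\<lambda>n. N n x) at_top sequentially" if x: "x \<in> X" for x
  proof -
    have "filterlim (\<lambda>n. design_weight d n x * real n) at_top sequentially"
      by (rule filterlim_tendsto_pos_mult_at_top[OF weights[OF x] w_pos[OF x] filterlim_real_sequentially])
    moreover have "eventually (\<lambda>n. design_weight d n x * real n = real (N n x)) sequentially"
      using eventually_gt_at_top[of 0] by eventually_elim (simp add: weight)
    ultimately have "filterlim (\<lambda>n. real (N n x)) at_top sequentially"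
      by (rule filterlim_mono_eventually[OF _ order_refl order_refl])
    then show ?thesis
      by (simp add: filterlim_sequentially_iff_filterlim_real)
  qed

  obtain \<Omega> :: "real measure" and U V where \<Omega>: "prob_space \<Omega>"
    and U: "\<forall>n. U n \<in> borel_measurable \<Omega>"
    and distr_U: "\<forall>n. distr \<Omega> borel (U n) = distr M borel (\<lambda>\<omega>. (\<Sum>i=1..n. \<epsilon> i \<omega>) / sqrt (real n))"
    and V[measurable]: "V \<in> borel_measurable \<Omega>"
    and distr_V: "distr \<Omega> borel V = normal_law 0 (\<sigma>\<^sup>2)"
    and lim: "\<forall>u\<in>space \<Omega>. (\<lambda>n. U n u) \<longlonglongrightarrow> V u"
    using central_limit_theorem_Skorohod[OF indep ident square_int mean var] by auto
  note [measurable] = U[rule_format]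
  \<comment> \<open>One independent copy of the Skorohod space for each design point, matching the
    independence of the cells.\<close>
  define P where "P = (\<Pi>\<^sub>M x\<in>X. \<Omega>)"
  have P: "prob_space P"
    unfolding P_def by (intro prob_space_PiM \<Omega>)

  \<comment> \<open>\<open>Z\<close> is the rescaled noise of the cell means, and \<open>H n\<close>
    turns it into the rescaled error of the estimator. \<open>T n\<close> and \<open>T'\<close> are
    the versions of \<open>Z n\<close> and of its Gaussian limit on \<open>P\<close>; the factor
    \<open>a n x\<close> changes the normalization from the cell count to \<open>n\<close>.\<close>
  define Z where "Z n \<omega> x = sqrt (real n) * ((\<Sum>i\<in>J n x. \<epsilon> i \<omega>) / real (N n x))" for n \<omega> x
  define a where "a n x = sqrt (real n) / sqrt (real (N n x))" for n x
  define H where "H n z = (\<lambda>x\<in>X. sqrt (real n) *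
    (isotonic_regression X (design_weight d n) (\<lambda>x. g x + z x / sqrt (real n)) x - g x))" for n z
  define T where "T n u = (\<lambda>x\<in>X. a n x * U (N n x) (u x))" for n and u :: "'i \<Rightarrow> real"
  define T' where "T' u = (\<lambda>x\<in>X. V (u x) / sqrt (w x))" for u :: "'i \<Rightarrow> real"

  have Z_rv[measurable]: "random_variable borel (\<lambda>\<omega>. Z n \<omega> x)" for n x
    unfolding Z_def by measurable
  have T_meas: "T n \<in> P \<rightarrow>\<^sub>M ?R" for n
    unfolding T_def P_def by (intro measurable_restrict) measurable
  have T'_meas: "T' \<in> P \<rightarrow>\<^sub>M ?R"
    unfolding T'_def P_def by (intro measurable_restrict) measurable

  have Z_distr: "distr M borel (\<lambda>\<omega>. Z n \<omega> x) = distr \<Omega> borel (\<lambda>u. a n x * U (N n x) u)" for n x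
  proof -
    have "distr M borel (\<lambda>\<omega>. Z n \<omega> x) =
        distr (distr M borel (\<lambda>\<omega>. \<Sum>i\<in>J n x. \<epsilon> i \<omega>)) borel (\<lambda>s. sqrt (real n) * (s / real (N n x)))"
      by (subst distr_distr) (auto simp: o_def Z_def)
    also have "distr M borel (\<lambda>\<omega>. \<Sum>i\<in>J n x. \<epsilon> i \<omega>) = distr M borel (\<lambda>\<omega>. \<Sum>i=1..N n x. \<epsilon> i \<omega>)"
    proof (rule distr_iid_sum_card_cong[OF indep])
      show "distr M borel (\<epsilon> i) = distr M borel (\<epsilon> j)" if "i \<in> {1..}" "j \<in> {1..}" for i j
        using that by (intro ident) auto
    qed (use J in \<open>auto simp: N_def\<close>)
    also have "distr \<dots> borel (\<lambda>s. sqrt (real n) * (s / real (N n x))) =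
        distr M borel (\<lambda>\<omega>. sqrt (real n) * ((\<Sum>i=1..N n x. \<epsilon> i \<omega>) / real (N n x)))"
      by (subst distr_distr) (auto simp: o_def simp del: One_nat_def)
    \<comment> \<open>For an empty cell both expressions are 0, since division by 0 gives 0.\<close>
    also have "\<dots> = distr M borel (\<lambda>\<omega>. a n x * ((\<Sum>i=1..N n x. \<epsilon> i \<omega>) / sqrt (real (N n x))))"
      by (simp add: a_def)
    also have "\<dots> = distr (distr M borel (\<lambda>\<omega>. (\<Sum>i=1..N n x. \<epsilon> i \<omega>) / sqrt (real (N n x)))) borel (\<lambda>s. a n x * s)"
      by (subst distr_distr) (auto simp: o_def simp del: One_nat_def)
    also have "\<dots> = distr (distr \<Omega> borel (U (N n x))) borel (\<lambda>s. a n x * s)"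
      using distr_U by simp
    also have "\<dots> = distr \<Omega> borel (\<lambda>u. a n x * U (N n x) u)"
      using U by (subst distr_distr) (auto simp: o_def simp del: One_nat_def)
    finally show ?thesis .
  qed

  \<comment> \<open>Different points use disjoint sets of indices, so these are functions of
    disjoint blocks of independent errors.\<close>
  have Z_indep: "indep_vars (\<lambda>_. borel) (\<lambda>x \<omega>. Z n \<omega> x) X" for n
  proof -
    have "indep_vars (\<lambda>x. \<Pi>\<^sub>M i\<in>J n x. borel) (\<lambda>x \<omega>. restrict (\<lambda>i. \<epsilon> i \<omega>) (J n x)) X"
      using J(2) by (intro indep_vars_restrict[OF indep]) (auto simp: disjoint_family_on_def J_def)
    then have "indep_vars (\<lambda>_. borel) (\<lambda>x \<omega>. (\<lambda>e. sqrt (real n) * ((\<Sum>i\<in>J n x. e i) / real (N n x)))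
        (restrict (\<lambda>i. \<epsilon> i \<omega>) (J n x))) X"
      by (rule indep_vars_compose2) measurable
    then show ?thesis by (simp add: Z_def)
  qed
  have Z_law: "distr M ?R (\<lambda>\<omega>. \<lambda>x\<in>X. Z n \<omega> x) = distr P ?R (T n)" for n
  proof -
    have "distr M ?R (\<lambda>\<omega>. \<lambda>x\<in>X. Z n \<omega> x) = (\<Pi>\<^sub>M x\<in>X. distr M borel (\<lambda>\<omega>. Z n \<omega> x))"
      using Z_indep by (subst (asm) indep_vars_iff_distr_eq_PiM'[OF X_ne]) auto
    also have "\<dots> = distr P ?R (T n)"
      unfolding Z_distr P_def T_def using \<Omega> U by (subst distr_PiM_componentwise[OF X]) auto
    finally show ?thesis .
  qed
  have limit_law: "centered_diag_gaussian X (\<lambda>x. \<sigma>\<^sup>2 / w x) = distr P ?R T'"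
  proof -
    have "normal_law 0 (\<sigma>\<^sup>2 / w x) = distr \<Omega> borel (\<lambda>u. V u / sqrt (w x))" for x
      unfolding normal_law_divide_sqrt[symmetric] distr_V[symmetric]
      by (subst distr_distr) (auto simp: o_def simp del: One_nat_def)
    then show ?thesis
      unfolding centered_diag_gaussian_def P_def T'_def
      using \<Omega> by (subst distr_PiM_componentwise[OF X]) auto
  qed

  \<comment> \<open>Positive weights exclude empty cells, so each cell mean really is
    \<open>g x\<close> plus averaged noise.\<close>
  have estimator: "(\<lambda>x\<in>X. sqrt (real n) * (isotonic_lse X d (\<lambda>i. Y i \<omega>) n x - g x)) = H n (\<lambda>x\<in>X. Z n \<omega> x)"
    if pos: "\<forall>x\<in>X. 0 < design_weight d n x" and \<omega>: "\<omega> \<in> space M" for n \<omega>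
  proof -
    have "cell_mean d (\<lambda>i. Y i \<omega>) n x = g x + restrict (Z n \<omega>) X x / sqrt (real n)" if x: "x \<in> X" for x
    proof -
      have "(\<Sum>i\<in>J n x. Y i \<omega>) = (\<Sum>i\<in>J n x. g x + \<epsilon> i \<omega>)"
        using model[OF _ \<omega>] by (intro sum.cong) (auto simp: J_def)
      then show ?thesis
        using N_pos[of n x] pos x
        unfolding cell_mean_eq_sum J_def[symmetric] N_def[symmetric]
        by (simp add: Z_def sum.distrib add_divide_distrib flip: N_def)
    qed
    then have "isotonic_regression X (design_weight d n) (cell_mean d (\<lambda>i. Y i \<omega>) n) =
        isotonic_regression X (design_weight d n) (\<lambda>x. g x + restrict (Z n \<omega>) X x / sqrt (real n))"
      by (rule isotonic_regression_cong)
    then show ?thesis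
      by (simp add: H_def isotonic_lse_def)
  qed

  have "weak_conv_vec X
      (\<lambda>n. distr M ?R (\<lambda>\<omega>. \<lambda>x\<in>X. sqrt (real n) * (isotonic_lse X d (\<lambda>i. Y i \<omega>) n x - g x)))
      (distr (centered_diag_gaussian X (\<lambda>x. \<sigma>\<^sup>2 / w x)) ?R (levelwise_isotonic_regression X g w))"
  proof (rule weak_conv_vec_pointwise[OF P,
        where T = "\<lambda>n u. H n (T n u)" and T' = "\<lambda>u. levelwise_isotonic_regression X g w (T' u)"])
    show "eventually (\<lambda>n. (\<lambda>u. H n (T n u)) \<in> P \<rightarrow>\<^sub>M ?R \<and>
        distr M ?R (\<lambda>\<omega>. \<lambda>x\<in>X. sqrt (real n) * (isotonic_lse X d (\<lambda>i. Y i \<omega>) n x - g x)) =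
        distr P ?R (\<lambda>u. H n (T n u))) sequentially"
      using weight_pos
    proof eventually_elim
      case (elim n)
      have H_meas: "H n \<in> ?R \<rightarrow>\<^sub>M ?R"
        unfolding H_def by (rule isotonic_regression_PiM_measurable[OF X elim])
      have "distr M ?R (\<lambda>\<omega>. \<lambda>x\<in>X. sqrt (real n) * (isotonic_lse X d (\<lambda>i. Y i \<omega>) n x - g x)) =
          distr M ?R (\<lambda>\<omega>. H n (\<lambda>x\<in>X. Z n \<omega> x))"
        using estimator[OF elim] by (intro distr_cong) auto
      also have "\<dots> = distr (distr M ?R (\<lambda>\<omega>. \<lambda>x\<in>X. Z n \<omega> x)) ?R (H n)"
        by (subst distr_distr[OF H_meas]) (auto simp: o_def)
      also have "\<dots> = distr P ?R (\<lambda>u. H n (T n u))"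
        unfolding Z_law by (subst distr_distr[OF H_meas T_meas]) (simp add: o_def)
      finally show ?case
        using measurable_compose[OF T_meas H_meas] by simp
    qed
    note lev_meas = levelwise_isotonic_regression_PiM_measurable[OF X w, of g]
    show "(\<lambda>u. levelwise_isotonic_regression X g w (T' u)) \<in> P \<rightarrow>\<^sub>M ?R"
      by (rule measurable_compose[OF T'_meas lev_meas])
    show "distr (centered_diag_gaussian X (\<lambda>x. \<sigma>\<^sup>2 / w x)) ?R (levelwise_isotonic_regression X g w) =
        distr P ?R (\<lambda>u. levelwise_isotonic_regression X g w (T' u))"
      unfolding limit_law by (subst distr_distr[OF lev_meas T'_meas]) (simp add: o_def)
    fix u x assume u: "u \<in> space P" and x: "x \<in> X"
    have "(\<lambda>n. T n u y) \<longlonglongrightarrow> T' u y" if y: "y \<in> X" for y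
    proof -
      \<comment> \<open>The Skorohod sequence is run along the cell counts, which tend to infinity
        because the limit weight is positive; the first factor is \<open>a n y\<close>.\<close>
      have "(\<lambda>n. 1 / sqrt (design_weight d n y) * U (N n y) (u y)) \<longlonglongrightarrow> 1 / sqrt (w y) * V (u y)"
      proof (intro tendsto_intros weights[OF y])
        have "u y \<in> space \<Omega>" using u y by (auto simp: P_def space_PiM)
        with lim have "(\<lambda>n. U n (u y)) \<longlonglongrightarrow> V (u y)" by blast
        from filterlim_compose[OF this N_top[OF y]] show "(\<lambda>n. U (N n y) (u y)) \<longlonglongrightarrow> V (u y)" .
      qed (use w_pos[OF y] in auto)
      moreover have "T n u y = 1 / sqrt (design_weight d n y) * U (N n y) (u y)" for n
        using y by (simp add: T_def a_def weight real_sqrt_divide)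
      ultimately show ?thesis
        using y by (simp add: T'_def)
    qed
    then have "(\<lambda>n. sqrt (real n) *
        (isotonic_regression X (design_weight d n) (\<lambda>x. g x + T n u x / sqrt (real n)) x - g x))
        \<longlonglongrightarrow> levelwise_isotonic_regression X g w (T' u) x"
      using weights x
      by (intro isotonic_regression_rescaled_tendsto[OF X g w])
        (auto intro!: filterlim_compose[OF sqrt_at_top filterlim_real_sequentially])
    then show "(\<lambda>n. H n (T n u) x) \<longlonglongrightarrow> levelwise_isotonic_regression X g w (T' u) x"
      using x by (simp add: H_def)
  qed
  then show ?thesis
    by (simp add: converges_in_distribution_def)
qed

text \<open>A cell holds about \<open>n * w x\<close> observations, so the rescaled noise of its
  mean has limit variance \<open>\<sigma>\<^sup>2 / w x\<close>, and not
  \<open>\<sigma>\<^sup>2 * w x\<close> as in the English statement. Independence of the errors is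
  explicit: errors that all equal one variable are identically distributed but obey no central limit
  theorem.\<close>

theorem theorem5:
  fixes r1 r2 :: nat
    and X :: "(nat \<times> nat) set"
    and g w :: "nat \<times> nat \<Rightarrow> real"
    and M :: "'a measure"
    and Y \<epsilon> :: "nat \<Rightarrow> 'a \<Rightarrow> real"
    and d :: "nat \<Rightarrow> nat \<times> nat"
    and \<sigma> :: real
  assumes X: "X = {1..r1} \<times> {1..r2}"
    and g: "mono_on X g"
    and M: "prob_space M"
    and design: "\<And>i. i \<ge> 1 \<Longrightarrow> d i \<in> X"
    and model: "\<And>i \<omega>. i \<ge> 1 \<Longrightarrow> \<omega> \<in> space M \<Longrightarrow> Y i \<omega> = g (d i) + \<epsilon> i \<omega>"
    and indep: "prob_space.indep_vars M (\<lambda>_. borel) \<epsilon> {1..}"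
    and ident: "\<And>i j. i \<ge> 1 \<Longrightarrow> j \<ge> 1 \<Longrightarrow> distr M borel (\<epsilon> i) = distr M borel (\<epsilon> j)"
    and square_int: "\<And>i. i \<ge> 1 \<Longrightarrow> integrable M (\<lambda>\<omega>. (\<epsilon> i \<omega>)\<^sup>2)"
    and mean: "\<And>i. i \<ge> 1 \<Longrightarrow> prob_space.expectation M (\<epsilon> i) = 0"
    and var: "\<And>i. i \<ge> 1 \<Longrightarrow> prob_space.variance M (\<epsilon> i) = \<sigma>\<^sup>2"
    and weights: "\<And>x. x \<in> X \<Longrightarrow> (\<lambda>n. design_weight d n x) \<longlonglongrightarrow> w x"
    and w_pos: "\<And>x. x \<in> X \<Longrightarrow> w x > 0"
  shows "converges_in_distribution M X
           (\<lambda>n \<omega> x. sqrt (real n) * (isotonic_lse X d (\<lambda>i. Y i \<omega>) n x - g x))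
           (distr (centered_diag_gaussian X (\<lambda>x. \<sigma>\<^sup>2 / w x)) (\<Pi>\<^sub>M x\<in>X. borel)
              (levelwise_isotonic_regression X g w))"
proof (rule isotonic_lse_converges_in_distribution)
  show "finite X" unfolding X by simp
qed (fact assms)+

end
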